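(* Let $T, D \ge 1$ be integers, let $s_0 \in \mathbb{R}^D$, and let $f_1,\dots,f_T : \mathbb{R}^D \to \mathbb{R}^D$ be differentiable. For $\mathbf{s} = \operatorname{vec}(s_1,\dots,s_T) \in \mathbb{R}^{TD}$ let $J_t = J_t(\mathbf{s}) = \frac{\partial f_t}{\partial s_{t-1}}(s_{t-1})$ for $2 \le t \le T$, and let $\mathbf{J}(\mathbf{s}) \in \mathbb{R}^{TD \times TD}$ be the Jacobian of the residual function. Let $\mu := \inf_{\mathbf{s} \in \mathbb{R}^{TD}} \sigma_{\min}^2(\mathbf{J}(\mathbf{s}))$. Assume that there are constants $\lambda \in \mathbb{R}$, $a \ge 1$ and $0 < b \le 1$ such that the LLE regularity condition holds: $$ b\, e^{\lambda k} \ \le\ \| J_{t+k-1} J_{t+k-2} \cdots J_t \|_2 \ \le\ a\, e^{\lambda k} $$ for all $t > 1$, all $k \ge 0$ with $t+k-1 \le T$, and all $\mathbf{s} \in \mathbb{R}^{TD}$ (for $k=0$ the product is the identity). If $\lambda \ne 0$, then $$ \frac{1}{a} \cdot \frac{e^{\lambda} - 1}{e^{\lambda T} - 1} \ \le\ \sqrt{\mu} \ \le\ \min\left( \frac{1}{b} \cdot \frac{1}{e^{\lambda (T-1)}},\ 1 \right). $$ If $\lambda = 0$, then $$ \frac{1}{aT} \ \le\ \sqrt{\mu} \ \le\ \min\left( \frac{1}{b} \sqrt{\frac{2D}{T+1}},\ 1 \right). $$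
   Context: Consider the nonlinear state space model $s_t = f_t(s_{t-1}) \in \mathbb{R}^D$, $t=1,\dots,T$, with fixed initial condition $s_0$. The residual function is $$\mathbf{r}(\mathbf{s}) = \operatorname{vec}\big([s_1 - f_1(s_0), \ldots, s_T - f_T(s_{T-1})]\big) \in \mathbb{R}^{TD}, \qquad \mathbf{s} = \operatorname{vec}(s_1,\dots,s_T) \in \mathbb{R}^{TD},$$ where $\operatorname{vec}$ stacks vectors into one column. The merit function is $\mathcal{L}(\mathbf{s}) = \frac12 \|\mathbf{r}(\mathbf{s})\|_2^2$. The Jacobian $\mathbf{J}(\mathbf{s}) = \frac{\partial \mathbf{r}}{\partial \mathbf{s}}(\mathbf{s})$ is block bidiagonal with $D\times D$ blocks: its diagonal blocks are $I_D$, its block in block-row $t$ and block-column $t-1$ is $-J_t$ for $t=2,\dots,T$, and all other blocks are zero. $\sigma_{\min}$ denotes the smallest singular value and $\|\cdot\|_2$ the spectral norm. The quantity $\mu$ is the Polyak–Łojasiewicz (PL) constant associated with $\mathcal{L}$, in the sense that $\frac12\|\nabla \mathcal{L}(\mathbf{s})\|^2 \ge \mu(\mathcal{L}(\mathbf{s}) - \mathcal{L}(\mathbf{s}^* ))$ for all $\mathbf{s}$, where $\mathbf{s}^*$ is the unique zero of $\mathbf{r}$. The number $\lambda$ plays the role of the Largest Lyapunov Exponent (LLE) $\lim_{T\to\infty} \frac1T \log\|J_T \cdots J_1\|$ of the model. *)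

theory Defs
  imports "HOL-Analysis.Analysis"
begin

text \<open>
  The time horizon is \<open>T = CARD('t)\<close> and the state dimension is \<open>D = CARD('d)\<close>. A stacked
  trajectory \<open>vec(s_1, ..., s_T)\<close> is a vector whose coordinates are indexed by \<open>'t \<times> 'd\<close>, the
  coordinate \<open>(i, j)\<close> being component \<open>j\<close> of the state at the time of block \<open>i\<close>. The order on \<open>'t\<close>
  numbers the blocks \<open>1, ..., T\<close>.
\<close>

definition time_of :: "'t::{finite,linorder} \<Rightarrow> nat" where
  "time_of i = card {..i}"

definition block_at :: "nat \<Rightarrow> 't::{finite,linorder}" where
  "block_at t = inv time_of t"

lemma strict_mono_time_of: "strict_mono time_of"
  unfolding strict_mono_def time_of_def by (auto intro!: psubset_card_mono)

lemma bij_betw_time_of: "bij_betw time_of (UNIV :: 't::{finite,linorder} set) {1..CARD('t)}"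
proof -
  have inj: "inj (time_of :: 't \<Rightarrow> nat)"
    using strict_mono_time_of by (rule strict_mono_imp_inj_on)
  have "time_of i \<in> {1..CARD('t)}" for i :: 't
  proof -
    have "card {i} \<le> card {..i}" by (rule card_mono) auto
    then show ?thesis by (auto simp: time_of_def intro: card_mono)
  qed
  then have "range (time_of :: 't \<Rightarrow> nat) = {1..CARD('t)}"
    by (intro card_subset_eq) (auto simp: card_image[OF inj])
  with inj show ?thesis by (simp add: bij_betw_def)
qed

lemma block_at_time_of [simp]: "block_at (time_of i) = i"
  unfolding block_at_def by (rule inv_f_f[OF bij_betw_imp_inj_on[OF bij_betw_time_of]])

lemma time_of_block_at:
  "1 \<le> t \<Longrightarrow> t \<le> CARD('t) \<Longrightarrow> time_of (block_at t :: 't::{finite,linorder}) = t"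
  unfolding block_at_def using bij_betw_time_of[where 't='t]
  by (intro f_inv_into_f) (auto simp: bij_betw_def)

text \<open>The state \<open>s_t\<close>; meaningful for \<open>t \<le> CARD('t)\<close> only.\<close>

definition state_at ::
  "real^'d \<Rightarrow> real^('t::{finite,linorder} \<times> 'd) \<Rightarrow> nat \<Rightarrow> real^'d" where
  "state_at s0 s t = (if t = 0 then s0 else (\<chi> j. s $ (block_at t, j)))"

definition residual ::
  "(nat \<Rightarrow> real^'d \<Rightarrow> real^'d) \<Rightarrow> real^'d \<Rightarrow>
    real^('t::{finite,linorder} \<times> 'd) \<Rightarrow> real^('t \<times> 'd)" where
  "residual f s0 s =
    (\<chi> p. (state_at s0 s (time_of (fst p))
          - f (time_of (fst p)) (state_at s0 s (time_of (fst p) - 1))) $ snd p)"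

definition dyn_jacobian ::
  "(nat \<Rightarrow> real^'d \<Rightarrow> real^'d) \<Rightarrow> real^'d \<Rightarrow>
    real^('t::{finite,linorder} \<times> 'd) \<Rightarrow> nat \<Rightarrow> real^'d^'d" where
  "dyn_jacobian f s0 s t = jacobian (f t) (at (state_at s0 s (t - 1)))"

text \<open>\<open>jacobian_prod f s0 s t k\<close> is \<open>J_{t+k-1} ... J_{t+1} J_t\<close>.\<close>

primrec jacobian_prod ::
  "(nat \<Rightarrow> real^'d \<Rightarrow> real^'d) \<Rightarrow> real^'d \<Rightarrow>
    real^('t::{finite,linorder} \<times> 'd) \<Rightarrow> nat \<Rightarrow> nat \<Rightarrow> real^'d^'d" where
  "jacobian_prod f s0 s t 0 = mat 1"
| "jacobian_prod f s0 s t (Suc k) = dyn_jacobian f s0 s (t + k) ** jacobian_prod f s0 s t k"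

definition spectral_norm :: "real^'n^'m \<Rightarrow> real" where
  "spectral_norm A = onorm ((*v) A)"

text \<open>Square roots of the eigenvalues of \<open>A\<^sup>T A\<close>.\<close>

definition singular_values :: "real^'n^'n \<Rightarrow> real set" where
  "singular_values A =
    {sqrt e | e. \<exists>v. v \<noteq> 0 \<and> (transpose A ** A) *v v = e *\<^sub>R v}"

definition sigma_min :: "real^'n^'n \<Rightarrow> real" where
  "sigma_min A = (LEAST \<sigma>. \<sigma> \<in> singular_values A)"

end

theory Submission
  imports Defs
begin

text \<open>
  Write \<open>J\<close> for the Jacobian of the residual. The singular value \<open>sigma_min J\<close> is the least factor
  by which \<open>J\<close> stretches a vector, so both bounds are statements about the size of the inverse of
  \<open>J\<close>. That inverse is explicit: solving \<open>J x = y\<close> means running the linearised dynamics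
  \<open>x\<^sub>t = J\<^sub>t x\<^sub>t\<^sub>-\<^sub>1 + y\<^sub>t\<close> from \<open>x\<^sub>0 = 0\<close> with forcing \<open>y\<close>, so the block of the inverse in row
  \<open>t\<close> and column \<open>j \<le> t\<close> is the transition matrix \<open>J\<^sub>t \<dots> J\<^sub>j\<^sub>+\<^sub>1\<close> from \<open>j\<close> to \<open>t\<close>, whose
  norm the regularity condition controls.

  For the lower bound, the inverse is a sum over the lags \<open>k < T\<close> of block subdiagonals; each has
  norm at most the largest norm of its blocks, \<open>a e\<^bsup>\<lambda>k\<^esup>\<close>, and the geometric sum is the reciprocal of
  the claimed bound (lemma \<open>sigma_min_residual_jacobian_ge\<close>).

  For the upper bounds, the inverse is at least as large as what it does to a forcing \<open>v\<close>
  concentrated at one time \<open>j\<close>: the response at every \<open>t \<ge> j\<close> is the transition matrix applied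
  to \<open>v\<close> (lemma \<open>sigma_min_impulse_response\<close>). Forcing at the last time gives the bound \<open>1\<close>,
  since the response is the forcing itself. Forcing at the first time and observing only the last
  gives the exponential bound. When \<open>\<lambda> = 0\<close> no single block is known to be large, but all \<open>T (T + 1) / 2\<close>
  blocks have norm at least \<open>b\<close>; adding up the responses to all unit forcings compares the
  squared Frobenius norm of the inverse, at least \<open>b\<^sup>2 T (T + 1) / 2\<close>, with \<open>T D\<close> times its squared
  spectral norm.
\<close>

section \<open>The smallest singular value as a minimal stretching factor\<close>

text \<open>
  For small \<open>u\<close> the linear term dominates and changes sign with \<open>u\<close>.
\<close>

lemma linear_term_zero_if_quadratic_nonneg:
  fixes c d :: real
  assumes "\<And>u. 0 \<le> 2 * u * c + u\<^sup>2 * d"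
  shows "c = 0"
proof (rule ccontr)
  assume "c \<noteq> 0"
  define u where "u = - c / (1 + \<bar>d\<bar>)"
  have pos: "1 + \<bar>d\<bar> > 0" by simp
  have uc: "c = - u * (1 + \<bar>d\<bar>)" using pos by (simp add: u_def)
  have "u \<noteq> 0" using \<open>c \<noteq> 0\<close> pos by (simp add: u_def)
  have "2 * u * c + u\<^sup>2 * d = u\<^sup>2 * (d - 2 * (1 + \<bar>d\<bar>))"
    by (subst uc) (simp add: algebra_simps power2_eq_square)
  also have "\<dots> < 0" using \<open>u \<noteq> 0\<close> by (intro mult_pos_neg) auto
  finally show False using assms[of u] by simp
qed

text \<open>
  First-order optimality for the Rayleigh quotient: moving from \<open>v\<close> a little against the defect \<open>w\<close>
  of the eigenvalue equation lowers the quotient at first order unless the defect vanishes.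
\<close>

lemma least_stretched_is_eigenvector:
  fixes A :: "real^'n^'n"
  assumes v: "norm v = 1" and least: "\<And>x. norm x = 1 \<Longrightarrow> norm (A *v v) \<le> norm (A *v x)"
  shows "(transpose A ** A) *v v = (norm (A *v v))\<^sup>2 *\<^sub>R v"
proof -
  define m where "m = (norm (A *v v))\<^sup>2"
  define w where "w = (transpose A ** A) *v v - m *\<^sub>R v"
  have least': "m * (norm x)\<^sup>2 \<le> (norm (A *v x))\<^sup>2" for x
  proof (cases "x = 0")
    case False
    define y where "y = (1 / norm x) *\<^sub>R x"
    have "norm y = 1" using False by (simp add: y_def)
    have "x = norm x *\<^sub>R y" using False by (simp add: y_def)
    then have "norm (A *v x) = norm x * norm (A *v y)"
      by (metis matrix_vector_mult_scaleR norm_scaleR abs_norm_cancel)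
    moreover have "norm (A *v v) \<le> norm (A *v y)" using \<open>norm y = 1\<close> by (rule least)
    ultimately show ?thesis
      by (simp add: m_def power_mult_distrib mult.commute mult_left_mono power_mono)
  qed simp
  have adj: "(A *v x) \<bullet> (A *v y) = ((transpose A ** A) *v x) \<bullet> y" for x y
    by (simp add: dot_lmul_matrix[symmetric] matrix_vector_mul_assoc[symmetric]
        transpose_matrix_vector)
  have "0 \<le> 2 * u * (w \<bullet> w) + u\<^sup>2 * ((norm (A *v w))\<^sup>2 - m * (norm w)\<^sup>2)" for u
  proof -
    have image: "(norm (A *v (v + u *\<^sub>R w)))\<^sup>2
        = m + 2 * u * (((transpose A ** A) *v v) \<bullet> w) + u\<^sup>2 * (norm (A *v w))\<^sup>2"
      unfolding power2_norm_eq_inner m_def adj[symmetric]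
      by (simp add: matrix_vector_right_distrib matrix_vector_mult_scaleR inner_add_left
          inner_add_right inner_commute algebra_simps power2_eq_square)
    have arg: "(norm (v + u *\<^sub>R w))\<^sup>2 = 1 + 2 * u * (v \<bullet> w) + u\<^sup>2 * (norm w)\<^sup>2"
      using v unfolding power2_norm_eq_inner norm_eq_1
      by (simp add: inner_add_left inner_add_right inner_commute algebra_simps power2_eq_square)
    have self: "w \<bullet> w = ((transpose A ** A) *v v) \<bullet> w - m * (v \<bullet> w)"
      using inner_diff_left[of "(transpose A ** A) *v v" "m *\<^sub>R v" w]
      unfolding w_def[symmetric] by simp
    show ?thesis
      using least'[of "v + u *\<^sub>R w"] unfolding image arg self by (simp add: algebra_simps)
  qed
  then have "w \<bullet> w = 0" by (rule linear_term_zero_if_quadratic_nonneg)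
  then show ?thesis by (simp add: w_def m_def)
qed

text \<open>
  Compactness of the unit sphere gives a least stretched unit vector, whose stretching factor is a
  singular value; an eigenvector belonging to any singular value is stretched by exactly that value,
  which is therefore at least the minimum. In particular the set of singular values has a least element, so that the description
  \<open>LEAST\<close> in the definition of \<open>sigma_min\<close> denotes it.
\<close>

lemma sigma_min_attained:
  fixes A :: "real^'n^'n"
  obtains v where "norm v = 1" "sigma_min A = norm (A *v v)"
    "\<And>x. sigma_min A * norm x \<le> norm (A *v x)"
proof -
  have "compact (sphere (0 :: real^'n) 1)" by simp
  moreover have "sphere (0 :: real^'n) 1 \<noteq> {}" by simp
  moreover have "continuous_on (sphere 0 1) (\<lambda>x. norm (A *v x))"
    by (intro continuous_intros)
  ultimately obtain v where v: "norm v = 1"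
      and least: "\<And>x. norm x = 1 \<Longrightarrow> norm (A *v v) \<le> norm (A *v x)"
    using continuous_attains_inf[of "sphere 0 1" "\<lambda>x. norm (A *v x)"] by auto
  have "v \<noteq> 0" using v by auto
  have stretch: "norm (A *v v) * norm x \<le> norm (A *v x)" for x
  proof (cases "x = 0")
    case False
    have "norm (A *v v) \<le> norm (A *v ((1 / norm x) *\<^sub>R x))"
      using False by (intro least) simp
    then show ?thesis using False by (simp add: matrix_vector_mult_scaleR field_simps)
  qed simp
  have "sigma_min A = norm (A *v v)"
    unfolding sigma_min_def
  proof (rule Least_equality)
    show "norm (A *v v) \<in> singular_values A"
      using least_stretched_is_eigenvector[OF v least] \<open>v \<noteq> 0\<close>
      by (force simp: singular_values_def intro!: exI[of _ "(norm (A *v v))\<^sup>2"])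
  next
    fix \<sigma> assume "\<sigma> \<in> singular_values A"
    then obtain e w where \<sigma>: "\<sigma> = sqrt e" and w: "w \<noteq> 0" "(transpose A ** A) *v w = e *\<^sub>R w"
      by (auto simp: singular_values_def)
    have "(norm (A *v w))\<^sup>2 = ((transpose A ** A) *v w) \<bullet> w"
      by (simp add: power2_norm_eq_inner dot_lmul_matrix[symmetric]
          matrix_vector_mul_assoc[symmetric] transpose_matrix_vector)
    also have "\<dots> = e * (norm w)\<^sup>2" using w by (simp add: power2_norm_eq_inner)
    finally have "norm (A *v w) = \<sigma> * norm w"
      unfolding \<sigma> by (metis norm_ge_zero real_sqrt_mult real_sqrt_unique)
    with stretch[of w] w show "norm (A *v v) \<le> \<sigma>" by simp
  qed
  with that v stretch show thesis by metis
qed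

lemma sigma_min_nonneg: "0 \<le> sigma_min (A :: real^'n^'n)"
  by (rule sigma_min_attained[of A]) simp

lemma sigma_min_mult_norm_le: "sigma_min A * norm x \<le> norm (A *v x)" for A :: "real^'n^'n"
  by (rule sigma_min_attained[of A]) blast

lemma sigma_min_ge:
  fixes A :: "real^'n^'n"
  assumes "\<And>x. norm x \<le> C * norm (A *v x)" "0 < C"
  shows "1 / C \<le> sigma_min A"
proof (rule sigma_min_attained[of A])
  fix v assume "norm v = 1" "sigma_min A = norm (A *v v)"
  then show ?thesis using assms(1)[of v] assms(2) by (simp add: field_simps)
qed

section \<open>Spectral norms\<close>

lemma spectral_norm_bound: "norm (A *v x) \<le> spectral_norm A * norm x"
  for A :: "real^'n^'m"
  unfolding spectral_norm_def
  by (intro onorm linear_conv_bounded_linear[THEN iffD1] matrix_vector_mul_linear)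

text \<open>
  Cauchy-Schwarz applied to the expansion of \<open>A x\<close> in the columns of \<open>A\<close>.
\<close>

lemma spectral_norm_power2_le_frobenius:
  fixes A :: "real^'n^'m"
  shows "(spectral_norm A)\<^sup>2 \<le> (\<Sum>j\<in>UNIV. (norm (A *v axis j 1))\<^sup>2)"
proof -
  define F where "F = L2_set (\<lambda>j. norm (A *v axis j 1)) UNIV"
  have "norm (A *v x) \<le> F * norm x" for x
  proof -
    have "A *v x = (\<Sum>j\<in>UNIV. x $ j *\<^sub>R (A *v axis j 1))"
      by (subst matrix_mult_sum)
        (simp add: matrix_vector_mult_basis scalar_mult_eq_scaleR)
    then have "norm (A *v x) \<le> (\<Sum>j\<in>UNIV. \<bar>x $ j\<bar> * \<bar>norm (A *v axis j 1)\<bar>)"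
      by (simp add: sum_norm_le)
    also have "\<dots> \<le> L2_set (\<lambda>j. x $ j) UNIV * F"
      unfolding F_def by (rule L2_set_mult_ineq)
    also have "L2_set (\<lambda>j. x $ j) UNIV = norm x"
      by (simp add: norm_vec_def L2_set_def)
    finally show ?thesis by (simp add: mult.commute)
  qed
  then have "spectral_norm A \<le> F"
    unfolding spectral_norm_def by (intro onorm_bound) (simp add: F_def)
  moreover have "0 \<le> spectral_norm A"
    unfolding spectral_norm_def
    by (intro onorm_pos_le linear_conv_bounded_linear[THEN iffD1] matrix_vector_mul_linear)
  ultimately have "(spectral_norm A)\<^sup>2 \<le> F\<^sup>2" by (rule power_mono)
  also have "F\<^sup>2 = (\<Sum>j\<in>UNIV. (norm (A *v axis j 1))\<^sup>2)"
    by (simp add: F_def L2_set_def sum_nonneg)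
  finally show ?thesis .
qed

section \<open>Blocks of stacked trajectories and the residual Jacobian\<close>

lemma time_of_bounds: "1 \<le> time_of i" "time_of i \<le> CARD('t)" for i :: "'t::{finite,linorder}"
  using bij_betwE[OF bij_betw_time_of[where 't='t]] by auto

lemma state_at_time_of_nth: "state_at z x (time_of i) $ j = x $ (i, j)"
  for x :: "real^('t::{finite,linorder} \<times> 'd::finite)"
  using time_of_bounds(1)[of i] by (simp add: state_at_def)

lemma state_at_0 [simp]: "state_at z x 0 = z"
  by (simp add: state_at_def)

lemma norm_power2_eq_sum_blocks:
  fixes x :: "real^('t::{finite,linorder} \<times> 'd::finite)"
  shows "(norm x)\<^sup>2 = (\<Sum>t = 1..CARD('t). (norm (state_at 0 x t))\<^sup>2)"
proof -
  have nv: "(norm y)\<^sup>2 = (\<Sum>i\<in>UNIV. (y $ i)\<^sup>2)" for y :: "real^'n"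
    by (simp add: norm_vec_def L2_set_def sum_nonneg)
  have "(norm x)\<^sup>2 = (\<Sum>p\<in>UNIV \<times> UNIV. (x $ p)\<^sup>2)" by (simp add: nv)
  also have "\<dots> = (\<Sum>i\<in>UNIV. \<Sum>j\<in>UNIV. (x $ (i, j))\<^sup>2)"
    by (simp add: sum.cartesian_product)
  also have "\<dots> = (\<Sum>i\<in>(UNIV :: 't set). (norm (state_at 0 x (time_of i)))\<^sup>2)"
    by (simp add: nv state_at_time_of_nth)
  also have "\<dots> = (\<Sum>t = 1..CARD('t). (norm (state_at 0 x t))\<^sup>2)"
    using bij_betw_time_of[where 't='t] by (rule sum.reindex_bij_betw)
  finally show ?thesis .
qed

text \<open>
  The initial state does not vary with the trajectory, so reading off the state at time \<open>t\<close> has as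
  derivative the same operation with initial state \<open>0\<close>. This convention makes time \<open>1\<close> follow
  the same block formulas as all later times.
\<close>

lemma state_at_has_derivative:
  "((\<lambda>s. state_at z s t) has_derivative (\<lambda>h. state_at 0 h t)) (at s)"
  for s :: "real^('t::{finite,linorder} \<times> 'd::finite)"
proof (cases "t = 0")
  case False
  have "linear (\<lambda>h :: real^('t \<times> 'd). \<chi> j. h $ (block_at t, j))"
    by (rule linearI) (simp_all add: vec_eq_iff)
  then show ?thesis
    using False by (simp add: state_at_def linear_imp_has_derivative)
qed (simp add: state_at_def)

text \<open>
  This is the block bidiagonal form of the Jacobian, read blockwise on a vector instead of entrywise.
\<close>

lemma state_at_residual_jacobian:
  fixes s x :: "real^('t::{finite,linorder} \<times> 'd::finite)"
  assumes diff: "\<forall>t\<in>{1..CARD('t)}. \<forall>x. f t differentiable (at x)"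
    and t: "1 \<le> t" "t \<le> CARD('t)"
  shows "state_at 0 (jacobian (residual f z) (at s) *v x) t
    = state_at 0 x t - dyn_jacobian f z s t *v state_at 0 x (t - 1)"
proof -
  define d where "d p h = (state_at 0 h (time_of (fst p))
      - dyn_jacobian f z s (time_of (fst p)) *v state_at 0 h (time_of (fst p) - 1)) $ snd p"
    for p :: "'t \<times> 'd" and h :: "real^('t \<times> 'd)"
  have comp: "((\<lambda>s. residual f z s $ p) has_derivative d p) (at s)" for p
  proof -
    define u where "u = time_of (fst p)"
    have u: "1 \<le> u" "u \<le> CARD('t)"
      unfolding u_def by (rule time_of_bounds)+
    have "(f u has_derivative (\<lambda>h. dyn_jacobian f z s u *v h)) (at (state_at z s (u - 1)))"
      unfolding dyn_jacobian_def using diff u by (simp add: jacobian_works)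
    then have "((\<lambda>s. f u (state_at z s (u - 1))) has_derivative
        (\<lambda>h. dyn_jacobian f z s u *v state_at 0 h (u - 1))) (at s)"
      by (rule has_derivative_compose[OF state_at_has_derivative])
    then have "((\<lambda>s. state_at z s u - f u (state_at z s (u - 1))) has_derivative
        (\<lambda>h. state_at 0 h u - dyn_jacobian f z s u *v state_at 0 h (u - 1))) (at s)"
      by (intro has_derivative_diff state_at_has_derivative)
    from bounded_linear.has_derivative[OF bounded_linear_vec_nth this, of "snd p"]
    show ?thesis by (simp add: residual_def d_def[abs_def] u_def)
  qed
  have "(residual f z has_derivative (\<lambda>h. \<chi> p. d p h)) (at s)"
    by (subst has_derivative_componentwise_within)
      (auto simp: Basis_vec_def inner_axis comp)
  then have "frechet_derivative (residual f z) (at s) = (\<lambda>h. \<chi> p. d p h)"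
    by (rule frechet_derivative_at[symmetric])
  moreover have "residual f z differentiable (at s)"
    using \<open>(residual f z has_derivative _) (at s)\<close> by (rule differentiableI)
  ultimately have "jacobian (residual f z) (at s) *v x = (\<chi> p. d p x)"
    by (metis jacobian_works frechet_derivative_at)
  moreover have "time_of (block_at t :: 't) = t" using t by (rule time_of_block_at)
  ultimately show ?thesis using t by (simp add: state_at_def d_def vec_eq_iff)
qed

section \<open>Lower bound\<close>

lemma L2_set_sum_le: "L2_set (\<lambda>t. \<Sum>k<(n::nat). g k t) A \<le> (\<Sum>k<n. L2_set (g k) A)"
proof (induction n)
  case (Suc n)
  then show ?case
    using L2_set_triangle_ineq[of "\<lambda>t. \<Sum>k<n. g k t" "g n" A] by simp
qed (simp add: L2_set_def)

lemma norm_eq_L2_set_blocks: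
  "norm x = L2_set (\<lambda>t. norm (state_at 0 x t)) {1..CARD('t)}"
  for x :: "real^('t::{finite,linorder} \<times> 'd::finite)"
  by (simp only: L2_set_def norm_power2_eq_sum_blocks[symmetric] real_sqrt_abs abs_norm_cancel)

text \<open>
  Delaying a signal by \<open>k\<close> steps does not increase its energy. For \<open>t < k\<close> the truncated
  difference \<open>t - k\<close> is \<open>0\<close>, where the block is \<open>0\<close>: the delayed signal starts with zeros.
\<close>

lemma L2_set_delay_le:
  "L2_set (\<lambda>t. norm (state_at 0 y (t - k))) {1..CARD('t)} \<le> norm y"
  for y :: "real^('t::{finite,linorder} \<times> 'd::finite)"
proof -
  let ?h = "\<lambda>t. (norm (state_at 0 y t))\<^sup>2"
  let ?T = "CARD('t)"
  have "(\<Sum>t = 1..?T. ?h (t - k)) = (\<Sum>t = k + 1..?T. ?h (t - k))"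
    by (rule sum.mono_neutral_right) auto
  also have "\<dots> = (\<Sum>t \<in> (\<lambda>t. t - k) ` {k + 1..?T}. ?h t)"
    by (subst sum.reindex) (auto simp: inj_on_def)
  also have "\<dots> \<le> (\<Sum>t = 1..?T. ?h t)"
    by (rule sum_mono2) auto
  finally show ?thesis
    by (simp add: norm_eq_L2_set_blocks L2_set_def)
qed

text \<open>
  The solution of the forced linear recursion is the superposition of the forcing of \<open>k\<close> steps ago,
  transported to the present. This is the explicit inverse of the Jacobian.
\<close>

lemma variation_of_constants:
  fixes s x y :: "real^('t::{finite,linorder} \<times> 'd::finite)"
  assumes step: "\<And>t. 1 \<le> t \<Longrightarrow> t \<le> T \<Longrightarrow>
      state_at 0 y t = state_at 0 x t - dyn_jacobian f z s t *v state_at 0 x (t - 1)"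
    and "t \<le> T"
  shows "state_at 0 x t
    = (\<Sum>k<t. jacobian_prod f z s (t - k + 1) k *v state_at 0 y (t - k))"
  using \<open>t \<le> T\<close>
proof (induction t)
  case (Suc t)
  have "state_at 0 x (Suc t) = state_at 0 y (Suc t) + dyn_jacobian f z s (Suc t) *v state_at 0 x t"
    using step[of "Suc t"] Suc.prems by simp
  also have "dyn_jacobian f z s (Suc t) *v state_at 0 x t
    = (\<Sum>k<t. jacobian_prod f z s (Suc t - Suc k + 1) (Suc k) *v state_at 0 y (Suc t - Suc k))"
    using Suc
    by (simp add: linear_sum[OF matrix_vector_mul_linear] matrix_vector_mul_assoc)
  finally show ?case
    by (simp add: sum.lessThan_Suc_shift del: sum.lessThan_Suc)
qed simp

text \<open>
  Young's convolution inequality in blocks: the norms of the blocks of \<open>x\<close> are dominated by the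
  convolution of \<open>c\<close> with the norms of the blocks of \<open>y = J x\<close>, and convolution with \<open>c\<close> is a
  weighted sum of delays.
\<close>

lemma sigma_min_residual_jacobian_ge:
  fixes s :: "real^('t::{finite,linorder} \<times> 'd::finite)"
  assumes diff: "\<forall>t\<in>{1..CARD('t)}. \<forall>x. f t differentiable (at x)"
    and upper: "\<And>t k. 1 < t \<Longrightarrow> t + k - 1 \<le> CARD('t) \<Longrightarrow>
      spectral_norm (jacobian_prod f z s t k) \<le> c k"
    and c: "\<And>k. 0 < c k"
  shows "1 / (\<Sum>k<CARD('t). c k) \<le> sigma_min (jacobian (residual f z) (at s))"
proof (rule sigma_min_ge)
  let ?J = "jacobian (residual f z) (at s)"
  let ?T = "CARD('t)"
  show "0 < (\<Sum>k<?T. c k)" using c by (intro sum_pos) (auto simp: lessThan_empty_iff)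
  fix x
  define y where "y = ?J *v x"
  have step: "state_at 0 y t = state_at 0 x t - dyn_jacobian f z s t *v state_at 0 x (t - 1)"
    if "1 \<le> t" "t \<le> ?T" for t
    unfolding y_def using that by (rule state_at_residual_jacobian[OF diff])
  have "norm (state_at 0 x t) \<le> (\<Sum>k<?T. c k * norm (state_at 0 y (t - k)))"
    if t: "t \<in> {1..?T}" for t
  proof -
    have "state_at 0 x t = (\<Sum>k<t. jacobian_prod f z s (t - k + 1) k *v state_at 0 y (t - k))"
      using t
      by (intro variation_of_constants[where T = ?T, OF step]) auto
    also have "norm \<dots> \<le> (\<Sum>k<t. c k * norm (state_at 0 y (t - k)))"
    proof (rule sum_norm_le)
      fix k assume "k \<in> {..<t}"
      then have "spectral_norm (jacobian_prod f z s (t - k + 1) k) \<le> c k"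
        using t by (intro upper) auto
      then show "norm (jacobian_prod f z s (t - k + 1) k *v state_at 0 y (t - k))
          \<le> c k * norm (state_at 0 y (t - k))"
        by (meson mult_right_mono norm_ge_zero order_trans spectral_norm_bound)
    qed
    \<comment> \<open>The range of lags is made independent of \<open>t\<close>, so that the triangle inequality can
        separate the lags.\<close>
    also have "\<dots> \<le> (\<Sum>k<?T. c k * norm (state_at 0 y (t - k)))"
      using t c by (intro sum_mono2) (auto intro: less_imp_le)
    finally show ?thesis .
  qed
  then have "norm x \<le> L2_set (\<lambda>t. \<Sum>k<?T. c k * norm (state_at 0 y (t - k))) {1..?T}"
    unfolding norm_eq_L2_set_blocks by (rule L2_set_mono) auto
  also have "\<dots> \<le> (\<Sum>k<?T. L2_set (\<lambda>t. c k * norm (state_at 0 y (t - k))) {1..?T})"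
    by (rule L2_set_sum_le)
  also have "\<dots> \<le> (\<Sum>k<?T. c k * norm y)"
  proof (rule sum_mono)
    fix k
    show "L2_set (\<lambda>t. c k * norm (state_at 0 y (t - k))) {1..?T} \<le> c k * norm y"
      using c[of k] mult_left_mono[OF L2_set_delay_le[of y k], of "c k"]
      by (simp add: L2_set_right_distrib)
  qed
  finally show "norm x \<le> (\<Sum>k<?T. c k) * norm (?J *v x)"
    by (simp add: y_def sum_distrib_right)
qed

section \<open>Upper bounds\<close>

text \<open>
  The trajectory that rests until time \<open>j\<close>, jumps to \<open>v\<close> there and then evolves freely is mapped
  by the Jacobian to the impulse \<open>v\<close> at time \<open>j\<close>. Its squared norm is the sum below, and the
  Jacobian stretches it by at least \<open>sigma_min\<close>.
\<close>

lemma sigma_min_impulse_response: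
  fixes s :: "real^('t::{finite,linorder} \<times> 'd::finite)"
  assumes diff: "\<forall>t\<in>{1..CARD('t)}. \<forall>x. f t differentiable (at x)"
    and j: "1 \<le> j" "j \<le> CARD('t)"
  shows "(sigma_min (jacobian (residual f z) (at s)))\<^sup>2
      * (\<Sum>t = j..CARD('t). (norm (jacobian_prod f z s (j + 1) (t - j) *v v))\<^sup>2) \<le> (norm v)\<^sup>2"
proof -
  let ?J = "jacobian (residual f z) (at s)"
  let ?T = "CARD('t)"
  define resp where "resp t = (if t < j then 0 else jacobian_prod f z s (j + 1) (t - j) *v v)" for t
  define x :: "real^('t \<times> 'd)" where "x = (\<chi> p. resp (time_of (fst p)) $ snd p)"
  have x: "state_at 0 x t = resp t" if "t \<le> ?T" for t
  proof (cases "t = 0")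
    case False
    then show ?thesis using that
      by (simp add: state_at_def x_def vec_eq_iff time_of_block_at)
  qed (use j in \<open>simp add: resp_def\<close>)
  have Jx: "state_at 0 (?J *v x) t = (if t = j then v else 0)" if t: "t \<in> {1..?T}" for t
  proof -
    have "state_at 0 (?J *v x) t = resp t - dyn_jacobian f z s t *v resp (t - 1)"
      using t x[of t] x[of "t - 1"] by (auto simp: state_at_residual_jacobian[OF diff])
    also have "\<dots> = (if t = j then v else 0)"
    proof (cases "j < t")
      case True
      then obtain k where "t = j + Suc k" using less_iff_Suc_add by force
      then show ?thesis by (simp add: resp_def matrix_vector_mul_assoc)
    qed (use j t in \<open>auto simp: resp_def\<close>)
    finally show ?thesis .
  qed
  have "(norm (?J *v x))\<^sup>2 = (norm v)\<^sup>2"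
    using j by (simp add: norm_power2_eq_sum_blocks Jx if_distrib[of "\<lambda>u. (norm u)\<^sup>2"] sum.delta
        cong: if_cong)
  moreover have "(norm x)\<^sup>2 = (\<Sum>t = j..?T. (norm (jacobian_prod f z s (j + 1) (t - j) *v v))\<^sup>2)"
  proof -
    have "(norm x)\<^sup>2 = (\<Sum>t = 1..?T. (norm (resp t))\<^sup>2)"
      by (simp add: norm_power2_eq_sum_blocks x)
    also have "\<dots> = (\<Sum>t = j..?T. (norm (resp t))\<^sup>2)"
      using j by (intro sum.mono_neutral_right) (auto simp: resp_def)
    finally show ?thesis by (simp add: resp_def)
  qed
  moreover have "(sigma_min ?J)\<^sup>2 * (norm x)\<^sup>2 \<le> (norm (?J *v x))\<^sup>2"
    using power_mono[OF sigma_min_mult_norm_le[of ?J x], of 2] sigma_min_nonneg[of ?J]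
    by (simp add: power_mult_distrib)
  ultimately show ?thesis by simp
qed

text \<open>
  An impulse at the final time has no later consequences.
\<close>

lemma sigma_min_residual_jacobian_le_1:
  fixes s :: "real^('t::{finite,linorder} \<times> 'd::finite)"
  assumes diff: "\<forall>t\<in>{1..CARD('t)}. \<forall>x. f t differentiable (at x)"
  shows "sigma_min (jacobian (residual f z) (at s)) \<le> 1"
proof -
  obtain v :: "real^'d" where "norm v = 1" using vector_choose_size[of 1] by auto
  then have "(sigma_min (jacobian (residual f z) (at s)))\<^sup>2 \<le> 1"
    using sigma_min_impulse_response[OF diff, where j = "CARD('t)" and v = v and s = s and z = z]
    by simp
  then show ?thesis using power2_le_imp_le[of _ 1] by simp
qed

text \<open>
  An impulse at the first time, of whose response only the final block is kept.
\<close>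

lemma sigma_min_mult_spectral_norm_le_1:
  fixes s :: "real^('t::{finite,linorder} \<times> 'd::finite)"
  assumes diff: "\<forall>t\<in>{1..CARD('t)}. \<forall>x. f t differentiable (at x)"
  shows "sigma_min (jacobian (residual f z) (at s))
    * spectral_norm (jacobian_prod f z s 2 (CARD('t) - 1)) \<le> 1"
proof -
  let ?\<sigma> = "sigma_min (jacobian (residual f z) (at s))"
  let ?P = "jacobian_prod f z s 2 (CARD('t) - 1)"
  have "norm (?\<sigma> *\<^sub>R (?P *v v)) \<le> 1 * norm v" for v
  proof -
    have "(norm (?P *v v))\<^sup>2
        \<le> (\<Sum>t = 1..CARD('t). (norm (jacobian_prod f z s (1 + 1) (t - 1) *v v))\<^sup>2)"
      using member_le_sum[of "CARD('t)" "{1..CARD('t)}"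
          "\<lambda>t. (norm (jacobian_prod f z s (1 + 1) (t - 1) *v v))\<^sup>2"]
      by (simp add: Suc_leI numeral_2_eq_2)
    then have "?\<sigma>\<^sup>2 * (norm (?P *v v))\<^sup>2 \<le> (norm v)\<^sup>2"
      using sigma_min_impulse_response[OF diff, where j = 1 and v = v and s = s and z = z]
      by (smt (verit) One_nat_def Suc_leI le_refl mult_left_mono zero_le_power2 zero_less_card_finite)
    then have "(?\<sigma> * norm (?P *v v))\<^sup>2 \<le> (norm v)\<^sup>2" by (simp add: power_mult_distrib)
    then have "?\<sigma> * norm (?P *v v) \<le> norm v" by (rule power2_le_imp_le) simp
    then show ?thesis by (simp add: sigma_min_nonneg)
  qed
  then have "onorm (\<lambda>v. ?\<sigma> *\<^sub>R (?P *v v)) \<le> 1" by (intro onorm_bound) auto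
  moreover have "onorm (\<lambda>v. ?\<sigma> *\<^sub>R (?P *v v)) = ?\<sigma> * spectral_norm ?P"
    unfolding spectral_norm_def using sigma_min_nonneg[of "jacobian (residual f z) (at s)"]
    by (subst onorm_scaleR)
      (auto intro: linear_conv_bounded_linear[THEN iffD1] matrix_vector_mul_linear)
  ultimately show ?thesis by simp
qed

text \<open>
  Adding the responses to the unit impulses in all \<open>T D\<close> coordinates. The squared column norms of each
  transition matrix add up to its squared Frobenius norm, which is at least \<open>b\<^sup>2\<close>; there are \<open>T + 1 - j\<close> such
  matrices for impulses at time \<open>j\<close>.
\<close>

lemma sigma_min_power2_le_if_spectral_norm_ge:
  fixes s :: "real^('t::{finite,linorder} \<times> 'd::finite)"
  assumes diff: "\<forall>t\<in>{1..CARD('t)}. \<forall>x. f t differentiable (at x)"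
    and lower: "\<And>t k. 1 < t \<Longrightarrow> t + k - 1 \<le> CARD('t) \<Longrightarrow>
      b \<le> spectral_norm (jacobian_prod f z s t k)"
    and b: "0 < b"
  shows "(sigma_min (jacobian (residual f z) (at s)))\<^sup>2 * (b\<^sup>2 * (real CARD('t) + 1))
    \<le> 2 * real CARD('d)"
proof -
  let ?\<sigma> = "sigma_min (jacobian (residual f z) (at s))"
  let ?T = "CARD('t)"
  let ?P = "\<lambda>j t. jacobian_prod f z s (j + 1) (t - j)"
  have col: "?\<sigma>\<^sup>2 * (b\<^sup>2 * (real ?T + 1 - real j)) \<le> real CARD('d)" if j: "j \<in> {1..?T}" for j
  proof -
    have "b\<^sup>2 * (real ?T + 1 - real j) = (\<Sum>t = j..?T. b\<^sup>2)"
      using j by (simp add: of_nat_diff algebra_simps)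
    also have "\<dots> \<le> (\<Sum>t = j..?T. \<Sum>i\<in>UNIV. (norm (?P j t *v axis i 1))\<^sup>2)"
    proof (rule sum_mono)
      fix t assume "t \<in> {j..?T}"
      then have "b \<le> spectral_norm (?P j t)" using j by (intro lower) auto
      then have "b\<^sup>2 \<le> (spectral_norm (?P j t))\<^sup>2" using b by (intro power_mono) auto
      also note spectral_norm_power2_le_frobenius
      finally show "b\<^sup>2 \<le> (\<Sum>i\<in>UNIV. (norm (?P j t *v axis i 1))\<^sup>2)" .
    qed
    also have "\<dots> = (\<Sum>i\<in>UNIV. \<Sum>t = j..?T. (norm (?P j t *v axis i 1))\<^sup>2)"
      by (rule sum.swap)
    finally have "?\<sigma>\<^sup>2 * (b\<^sup>2 * (real ?T + 1 - real j))
        \<le> (\<Sum>i\<in>UNIV. ?\<sigma>\<^sup>2 * (\<Sum>t = j..?T. (norm (?P j t *v axis i 1))\<^sup>2))"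
      by (simp add: sum_distrib_left[symmetric] mult_left_mono)
    also have "\<dots> \<le> (\<Sum>i\<in>(UNIV :: 'd set). 1)"
    proof (rule sum_mono)
      fix i :: 'd
      show "?\<sigma>\<^sup>2 * (\<Sum>t = j..?T. (norm (?P j t *v axis i 1))\<^sup>2) \<le> 1"
        using sigma_min_impulse_response[OF diff, where j = j and v = "axis i 1"
            and s = s and z = z] j
        by simp
    qed
    finally show ?thesis by simp
  qed
  have "(\<Sum>j = 1..n. real m + 1 - real j) = real n * (2 * real m + 1 - real n) / 2" for n m :: nat
    by (induction n) (simp_all add: field_simps)
  from this[where n = ?T and m = ?T]
  have pairs: "(\<Sum>j = 1..?T. real ?T + 1 - real j) = real ?T * (real ?T + 1) / 2" by simp
  have "(\<Sum>j = 1..?T. ?\<sigma>\<^sup>2 * (b\<^sup>2 * (real ?T + 1 - real j))) \<le> (\<Sum>j = 1..?T. real CARD('d))"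
    using col by (rule sum_mono)
  then have "?\<sigma>\<^sup>2 * (b\<^sup>2 * (real ?T * (real ?T + 1) / 2)) \<le> real ?T * real CARD('d)"
    unfolding sum_distrib_left[symmetric] pairs by simp
  then have "real ?T * (?\<sigma>\<^sup>2 * (b\<^sup>2 * (real ?T + 1))) \<le> real ?T * (2 * real CARD('d))"
    by (simp add: field_simps)
  then show ?thesis by (rule mult_left_le_imp_le) simp
qed

section \<open>Bounds on the PL constant\<close>

theorem theorem2:
  fixes T D :: nat
    and s0 :: "real^'d"
    and f :: "nat \<Rightarrow> real^'d \<Rightarrow> real^'d"
    and mu lam a b :: real
  assumes T: "T = CARD('t::{finite,linorder})"
    and D: "D = CARD('d)"
    and diff: "\<And>t x. 1 \<le> t \<Longrightarrow> t \<le> T \<Longrightarrow> f t differentiable (at x)"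
    and mu_def: "mu = (INF s :: real^('t \<times> 'd). (sigma_min (jacobian (residual f s0) (at s)))\<^sup>2)"
    and a: "1 \<le> a"
    and b: "0 < b" "b \<le> 1"
    and regularity: "\<And>(s :: real^('t \<times> 'd)) t k. 1 < t \<Longrightarrow> t + k - 1 \<le> T \<Longrightarrow>
      b * exp (lam * real k) \<le> spectral_norm (jacobian_prod f s0 s t k) \<and>
      spectral_norm (jacobian_prod f s0 s t k) \<le> a * exp (lam * real k)"
  shows "(lam \<noteq> 0 \<longrightarrow>
      1 / a * ((exp lam - 1) / (exp (lam * real T) - 1)) \<le> sqrt mu \<and>
      sqrt mu \<le> min (1 / b * (1 / exp (lam * (real T - 1)))) 1) \<and>
    (lam = 0 \<longrightarrow>
      1 / (a * real T) \<le> sqrt mu \<and>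
      sqrt mu \<le> min (1 / b * sqrt (2 * real D / (real T + 1))) 1)"
proof -
  define \<sigma> where "\<sigma> s = sigma_min (jacobian (residual f s0) (at s))" for s :: "real^('t \<times> 'd)"
  have diff': "\<forall>t\<in>{1..CARD('t)}. \<forall>x. f t differentiable (at x)"
    using diff by (auto simp: T)
  have T1: "1 \<le> T" by (simp add: T Suc_leI)
  have reg: "b * exp (lam * real k) \<le> spectral_norm (jacobian_prod f s0 s t k)"
      "spectral_norm (jacobian_prod f s0 s t k) \<le> a * exp (lam * real k)"
    if "1 < t" "t + k - 1 \<le> CARD('t)" for s :: "real^('t \<times> 'd)" and t k
    using regularity[of t k s] that by (simp_all add: T)

  have mu_upper: "sqrt mu \<le> \<sigma> 0"
  proof -
    have "mu \<le> (\<sigma> 0)\<^sup>2"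
      unfolding mu_def \<sigma>_def by (rule cINF_lower) (auto intro!: bdd_belowI[of _ 0])
    then show ?thesis
      by (simp add: real_le_lsqrt real_sqrt_le_iff[of mu "(\<sigma> 0)\<^sup>2", symmetric]
          sigma_min_nonneg \<sigma>_def)
  qed
  have le_1: "sqrt mu \<le> 1"
    using mu_upper sigma_min_residual_jacobian_le_1[OF diff', where z = s0 and s = 0]
    unfolding \<sigma>_def by (rule order_trans)

  have mu_lower: "1 / (\<Sum>k<T. a * exp (lam * real k)) \<le> sqrt mu"
  proof -
    have pos: "0 < (\<Sum>k<T. a * exp (lam * real k))"
      using a T1 by (intro sum_pos) (auto simp: lessThan_empty_iff)
    have "1 / (\<Sum>k<T. a * exp (lam * real k)) \<le> \<sigma> s" for s
      unfolding \<sigma>_def T using a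
      by (intro sigma_min_residual_jacobian_ge[OF diff' reg(2)]) auto
    then have "(1 / (\<Sum>k<T. a * exp (lam * real k)))\<^sup>2 \<le> mu"
      unfolding mu_def \<sigma>_def[symmetric] using pos
      by (intro cINF_greatest) (auto intro!: power_mono simp del: power_one_over)
    then show ?thesis by (rule real_le_rsqrt)
  qed

  have nonzero: "1 / a * ((exp lam - 1) / (exp (lam * real T) - 1)) \<le> sqrt mu \<and>
      sqrt mu \<le> 1 / b * (1 / exp (lam * (real T - 1)))" if lam: "lam \<noteq> 0"
  proof
    have "(\<Sum>k<T. a * exp (lam * real k)) = a * (\<Sum>k<T. exp lam ^ k)"
      by (simp add: sum_distrib_left exp_of_nat_mult[symmetric] mult.commute)
    also have "\<dots> = a * ((exp (lam * real T) - 1) / (exp lam - 1))"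
      using lam by (subst geometric_sum) (auto simp: exp_of_nat_mult[symmetric] mult.commute)
    finally show "1 / a * ((exp lam - 1) / (exp (lam * real T) - 1)) \<le> sqrt mu"
      using mu_lower by simp
  next
    have "b * exp (lam * (real T - 1)) \<le> spectral_norm (jacobian_prod f s0 (0 :: real^('t \<times> 'd)) 2 (T - 1))"
      using reg(1)[of 2 "T - 1" 0] T1 by (simp add: T of_nat_diff)
    then have "\<sigma> 0 * (b * exp (lam * (real T - 1))) \<le> 1"
      using sigma_min_mult_spectral_norm_le_1[OF diff', where z = s0 and s = 0]
      by (smt (verit) T \<sigma>_def mult_left_mono sigma_min_nonneg)
    then have "\<sigma> 0 \<le> 1 / b * (1 / exp (lam * (real T - 1)))"
      using b by (simp add: field_simps)
    with mu_upper show "sqrt mu \<le> 1 / b * (1 / exp (lam * (real T - 1)))" by simp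
  qed

  have zero: "1 / (a * real T) \<le> sqrt mu \<and> sqrt mu \<le> 1 / b * sqrt (2 * real D / (real T + 1))"
    if lam: "lam = 0"
  proof
    show "1 / (a * real T) \<le> sqrt mu" using mu_lower lam by (simp add: mult.commute)
  next
    have "(\<sigma> 0)\<^sup>2 * (b\<^sup>2 * (real T + 1)) \<le> 2 * real D"
      unfolding T D \<sigma>_def
      using reg(1) b lam by (intro sigma_min_power2_le_if_spectral_norm_ge[OF diff']) fastforce+
    then have "(\<sigma> 0 * b)\<^sup>2 \<le> 2 * real D / (real T + 1)"
      by (simp add: field_simps power_mult_distrib)
    then have "\<sigma> 0 * b \<le> sqrt (2 * real D / (real T + 1))"
      by (rule real_le_rsqrt)
    then have "\<sigma> 0 \<le> 1 / b * sqrt (2 * real D / (real T + 1))"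
      using b by (simp add: field_simps)
    with mu_upper show "sqrt mu \<le> 1 / b * sqrt (2 * real D / (real T + 1))" by simp
  qed

  show ?thesis using nonzero zero le_1 by simp
qed

end
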